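(* Let $K\ge1$ be odd and let $g:\{0,1\}^K\to\{0,1\}$ be the majority function. Let $\mathcal A$ be any randomized algorithm that takes as input $\mathcal S=(S_1,\dots,S_K)\in\{0,1\}^K$, outputs an element of $\{0,1\}$, and satisfies $\Pr[\mathcal A(\mathcal S)=g(\mathcal S)]\ge \frac12$ for every $\mathcal S\in\{0,1\}^K$. Then there exists a function $\gamma:\{0,1\}^K\to[0,1]$ such that the output distribution of $\mathsf{DaRRM}_\gamma$, run with success probability $p_\gamma=\gamma(\mathcal S)$, is the same as the output distribution of $\mathcal A$.
   Context: The outcomes $\mathcal S=(S_1,\dots,S_K)$ are the observed binary outputs $S_i\sim M_i(\mathcal D)$ of $K$ randomized mechanisms on a dataset $\mathcal D$; $\mathcal A$ is applied to them. Majority function: $g(S_1,\dots,S_K)=\mathbf 1\{\frac1K\sum_{i=1}^K S_i\ge\frac12\}$. Algorithm $\mathsf{DaRRM}_\gamma$ with a general noise function $\gamma$ of the observed outcomes: given $\mathcal S$, set $p_\gamma=\gamma(\mathcal S)$; with probability $p_\gamma$ output $g(\mathcal S)$, and otherwise output a uniformly random bit in $\{0,1\}$. *)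

theory Defs
  imports "HOL-Probability.Probability"
begin

text \<open>Bits are rendered as \<^typ>\<open>bool\<close>, with \<^term>\<open>True\<close> for 1. A randomized algorithm
  on K bits is a Markov kernel: it maps every input to the distribution of its output.\<close>

definition bit_tuples :: "nat \<Rightarrow> (nat \<Rightarrow> bool) set" where
  "bit_tuples K = {1..K} \<rightarrow>\<^sub>E UNIV"

definition majority :: "nat \<Rightarrow> (nat \<Rightarrow> bool) \<Rightarrow> bool" where
  "majority K S \<longleftrightarrow> 1 / real K * (\<Sum>i=1..K. of_bool (S i)) \<ge> 1 / 2"

text \<open>\<^const>\<open>bernoulli_pmf\<close> clamps its parameter to the unit interval, so the definition is
  meaningful only when \<open>\<gamma> S\<close> lies in \<open>{0..1}\<close>.\<close>

definition DaRRM :: "nat \<Rightarrow> ((nat \<Rightarrow> bool) \<Rightarrow> real) \<Rightarrow> (nat \<Rightarrow> bool) \<Rightarrow> bool pmf" where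
  "DaRRM K \<gamma> S = do {
     success \<leftarrow> bernoulli_pmf (\<gamma> S);
     if success then return_pmf (majority K S) else pmf_of_set UNIV
   }"

end

theory Submission
  imports Defs
begin

text \<open>Running DaRRM with success probability \<open>p\<close> outputs the majority bit with probability
  \<open>p + (1 - p) / 2\<close>. A distribution on \<open>{0,1}\<close> is determined by the mass of one of its points, so
  it suffices to solve for \<open>p\<close>; the solution \<open>2 Pr[A(S) = g(S)] - 1\<close> is nonnegative exactly
  because \<open>A\<close> is at least as accurate as a fair coin.\<close>

lemma pmf_bool_eqI:
  fixes p q :: "bool pmf"
  assumes "pmf p b = pmf q b"
  shows "p = q"
proof (rule pmf_eqI)
  fix c
  show "pmf p c = pmf q c"
    \<comment> \<open>Mass at \<open>False\<close> is one minus mass at \<open>True\<close>, so the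
      mixed cases reduce to the equal ones.\<close>
    using assms by (cases b; cases c) (simp_all add: pmf_False_conv_True)
qed

text \<open>The range assumption keeps \<open>bernoulli_pmf\<close> from clamping its parameter;
  outside the unit interval the formula fails.\<close>

lemma pmf_DaRRM_majority:
  assumes "\<gamma> S \<in> {0..1}"
  shows "pmf (DaRRM K \<gamma> S) (majority K S) = (1 + \<gamma> S) / 2"
  using assms by (simp add: DaRRM_def pmf_bind field_simps)

theorem lemma3p3:
  fixes K :: nat and A :: "(nat \<Rightarrow> bool) \<Rightarrow> bool pmf"
  assumes "K \<ge> 1" and "odd K"
    and "\<And>S. S \<in> bit_tuples K \<Longrightarrow> measure_pmf.prob (A S) {majority K S} \<ge> 1 / 2"
  shows "\<exists>\<gamma> \<in> bit_tuples K \<rightarrow> {0..1::real}. \<forall>S \<in> bit_tuples K. DaRRM K \<gamma> S = A S"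
proof -
  define \<gamma> where "\<gamma> S = 2 * pmf (A S) (majority K S) - 1" for S
  have range: "\<gamma> S \<in> {0..1}" if "S \<in> bit_tuples K" for S
    using assms(3)[OF that] pmf_le_1[of "A S" "majority K S"]
    by (simp add: \<gamma>_def measure_pmf_single)
  \<comment> \<open>Compared at the majority bit, \<open>(1 + \<gamma> S) / 2\<close> collapses to
    the mass that \<open>A S\<close> puts there once \<open>\<gamma>\<close> is unfolded.\<close>
  have "DaRRM K \<gamma> S = A S" if "S \<in> bit_tuples K" for S
    by (rule pmf_bool_eqI[where b = "majority K S"])
       (simp add: pmf_DaRRM_majority[where \<gamma> = \<gamma>, OF range[OF that]], simp add: \<gamma>_def)
  with range show ?thesis by blast
qed

end
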